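(* Let $\alpha,\beta>0$, let $\{U_n\}$ be i.i.d. random variables uniformly distributed on $(0,1)$, and let $X_n=\max\{U_n^{1/\alpha},U_{n-1}^{1/\beta}\}$ for every $n$ in the index set. Then: (a) For each $n$, $X_n$ has a $PFD(\alpha+\beta)$ distribution. (b) For each $n$ such that $n-1$ and $n$ are both in the index set, the joint distribution function of $(X_{n-1},X_n)$ is $$P(X_{n-1}\le x_{n-1},\,X_n\le x_n)=x_n^{\alpha}\,x_{n-1}^{\beta}\,\min\{x_n^{\beta},x_{n-1}^{\alpha}\},\qquad 0\le x_{n-1},x_n\le 1.$$ (c) $\{X_n\}$ is a stationary process and is not a Markov process.
   Context: For $\gamma>0$, $PFD(\gamma)$ (power function distribution) is the distribution on $[0,1]$ with distribution function $F(x)=x^{\gamma}$, $0\le x\le 1$. The index set of the process is either $\mathbb{Z}$ (with $U_n$ defined for all $n\in\mathbb{Z}$) or $\{0,1,2,\dots\}$ (with $U_n$ defined for all $n\ge -1$). Stationary means strictly stationary: all finite-dimensional distributions are invariant under shifts of the index. *)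

theory Defs
  imports "HOL-Probability.Probability"
begin

definition PFD_cdf :: "real \<Rightarrow> real \<Rightarrow> real" where
  "PFD_cdf \<gamma> x = (if x < 0 then 0 else if x \<le> 1 then x powr \<gamma> else 1)"

definition PFD :: "real \<Rightarrow> real measure" where
  "PFD \<gamma> = interval_measure (PFD_cdf \<gamma>)"

lemma PFD_cdf_props:
  assumes "\<gamma> > 0"
  shows PFD_cdf_mono: "x \<le> y \<Longrightarrow> PFD_cdf \<gamma> x \<le> PFD_cdf \<gamma> y"
    and continuous_PFD_cdf: "continuous (at_right a) (PFD_cdf \<gamma>)"
    and PFD_cdf_at_bot: "(PFD_cdf \<gamma> \<longlongrightarrow> 0) at_bot"
    and PFD_cdf_at_top: "(PFD_cdf \<gamma> \<longlongrightarrow> 1) at_top"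
proof -
  have eq: "PFD_cdf \<gamma> = (\<lambda>x. (max 0 (min 1 x)) powr \<gamma>)"
    by (auto simp: PFD_cdf_def fun_eq_iff max_def min_def)
  show "x \<le> y \<Longrightarrow> PFD_cdf \<gamma> x \<le> PFD_cdf \<gamma> y"
    unfolding eq using assms by (intro powr_mono2) auto
  have "continuous_on UNIV (PFD_cdf \<gamma>)"
    unfolding eq using assms by (intro continuous_on_powr' continuous_intros) auto
  then show "continuous (at_right a) (PFD_cdf \<gamma>)"
    by (meson UNIV_I continuous_at_imp_continuous_within continuous_on_eq_continuous_at open_UNIV)
  have "eventually (\<lambda>x::real. x < 0) at_bot"
    by (rule eventually_gt_at_bot)
  then show "(PFD_cdf \<gamma> \<longlongrightarrow> 0) at_bot"
    by (intro tendsto_eventually, elim eventually_mono) (auto simp: PFD_cdf_def)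
  have "eventually (\<lambda>x::real. x > 1) at_top"
    by (rule eventually_gt_at_top)
  then show "(PFD_cdf \<gamma> \<longlongrightarrow> 1) at_top"
    by (intro tendsto_eventually, elim eventually_mono) (auto simp: PFD_cdf_def)
qed

lemma real_distribution_PFD: "\<gamma> > 0 \<Longrightarrow> real_distribution (PFD \<gamma>)"
  unfolding PFD_def
  by (intro real_distribution_interval_measure PFD_cdf_props) auto

lemma cdf_PFD: "\<gamma> > 0 \<Longrightarrow> cdf (PFD \<gamma>) = PFD_cdf \<gamma>"
  unfolding PFD_def by (intro cdf_interval_measure PFD_cdf_props) auto

text \<open>Real-valued processes in discrete time; the index set \<open>I\<close> is a set of integers, and values
  \<open>X n\<close> with \<open>n \<notin> I\<close> are irrelevant.\<close>

definition real_process :: "'a measure \<Rightarrow> int set \<Rightarrow> (int \<Rightarrow> 'a \<Rightarrow> real) \<Rightarrow> bool" where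
  "real_process M I X \<longleftrightarrow> prob_space M \<and> (\<forall>n\<in>I. X n \<in> borel_measurable M)"

text \<open>Strict stationarity: \<open>(X j)\<close> and \<open>(X (j + h))\<close>, \<open>j \<in> J\<close>, have the same joint law for every
  finite \<open>J\<close> and every shift \<open>h\<close> that keeps \<open>J\<close> inside the index set.\<close>

definition stationary_process :: "'a measure \<Rightarrow> int set \<Rightarrow> (int \<Rightarrow> 'a \<Rightarrow> real) \<Rightarrow> bool" where
  "stationary_process M I X \<longleftrightarrow> real_process M I X \<and>
     (\<forall>J h. finite J \<longrightarrow> J \<subseteq> I \<longrightarrow> (\<lambda>j. j + h) ` J \<subseteq> I \<longrightarrow>
        distr M (\<Pi>\<^sub>M j\<in>J. borel) (\<lambda>\<omega>. \<lambda>j\<in>J. X (j + h) \<omega>) =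
        distr M (\<Pi>\<^sub>M j\<in>J. borel) (\<lambda>\<omega>. \<lambda>j\<in>J. X j \<omega>))"

definition generated_algebra :: "'a measure \<Rightarrow> int set \<Rightarrow> (int \<Rightarrow> 'a \<Rightarrow> real) \<Rightarrow> 'a measure" where
  "generated_algebra M K X =
     sigma (space M) (\<Union>k\<in>K. {X k -` B \<inter> space M | B. B \<in> sets borel})"

lemma subalgebra_generated_algebra:
  assumes "real_process M I X" "K \<subseteq> I"
  shows "subalgebra M (generated_algebra M K X)"
  using assms unfolding subalgebra_def generated_algebra_def real_process_def
  by (auto intro!: sets.sigma_sets_subset measurable_sets
           simp: space_measure_of_conv sets_measure_of_conv)

text \<open>The Markov property with respect to the natural filtration: the conditional law of
  \<open>X (n + 1)\<close> given \<open>X k\<close>, \<open>k \<le> n\<close>, is its conditional law given \<open>X n\<close> alone.\<close>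

definition markov_process :: "'a measure \<Rightarrow> int set \<Rightarrow> (int \<Rightarrow> 'a \<Rightarrow> real) \<Rightarrow> bool" where
  "markov_process M I X \<longleftrightarrow> real_process M I X \<and>
     (\<forall>n B. n \<in> I \<longrightarrow> n + 1 \<in> I \<longrightarrow> B \<in> sets borel \<longrightarrow>
        (AE \<omega> in M.
           real_cond_exp M (generated_algebra M {k \<in> I. k \<le> n} X)
             (indicator {\<omega>' \<in> space M. X (n + 1) \<omega>' \<in> B}) \<omega> =
           real_cond_exp M (generated_algebra M {n} X)
             (indicator {\<omega>' \<in> space M. X (n + 1) \<omega>' \<in> B}) \<omega>))"

end

theory Submission
  imports Defs
begin

text \<open>Parts (a), (b) and stationarity follow since \<open>X n \<le> x\<close> means \<open>U n \<le> x\<^sup>\<alpha>\<close> and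
  \<open>U (n - 1) \<le> x\<^sup>\<beta>\<close>, and since \<open>X\<close> is a shift-invariant function of the i.i.d. sequence \<open>U\<close>.

  For the failure of the Markov property fix \<open>0 < c < 1\<close> and \<open>y = c\<^bsup>\<alpha>/\<beta>\<^esup>\<close>. On the event \<open>H\<close> that
  \<open>X (n - 1)\<^sup>\<alpha> < X n\<^sup>\<beta>\<close> and \<open>X n > c\<close>, the maximum defining \<open>X n\<close> is attained by \<open>U n\<close>, so that
  \<open>X (n + 1) > y\<close>. If \<open>X\<close> were Markov, the conditional probability of \<open>X (n + 1) \<le> y\<close> given \<open>X n\<close>
  would vanish on \<open>H\<close>. But where it vanishes and \<open>X n > c\<close>, the value of \<open>X n\<close> lies in a null set:
  independently of \<open>U (n - 1)\<close>, both \<open>U n \<le> c\<^sup>\<alpha>\<close> and \<open>U (n + 1) \<le> y\<^sup>\<alpha>\<close> hold with positive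
  probability, and then \<open>X (n + 1) \<le> y\<close> while \<open>X n = U (n - 1)\<^bsup>1/\<beta>\<^esup>\<close> as soon as the latter
  exceeds \<open>c\<close>. Since \<open>H\<close> has positive probability, this is a contradiction.\<close>

section \<open>The uniform law on (0, 1) and power maps\<close>

abbreviation unif :: "real measure" where
  "unif \<equiv> uniform_measure lborel {0<..<1}"

lemma measure_unif: "A \<in> sets borel \<Longrightarrow> measure unif A = measure lborel ({0<..<1} \<inter> A)"
  by (subst measure_uniform_measure) auto

declare measure_uniform_measure [simp del]

lemma measure_unif_atMost:
  assumes "0 \<le> x" "x \<le> 1"
  shows "measure unif {..x} = x"
proof -
  have "measure unif {..x} = measure lborel ({0<..<1} \<inter> {..x})"
    by (rule measure_unif) simp
  also have "{0<..<1} \<inter> {..x} = (if x = 1 then {0<..<1} else {0<..x})"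
    using assms by auto
  finally show ?thesis
    using assms by (auto split: if_splits)
qed

lemma measure_unif_greaterThan:
  assumes "0 \<le> x" "x \<le> 1"
  shows "measure unif {x<..} = 1 - x"
proof -
  have "measure unif {x<..} = measure lborel ({0<..<1} \<inter> {x<..})"
    by (rule measure_unif) simp
  also have "{0<..<1} \<inter> {x<..} = {x<..<1}"
    using assms by auto
  finally show ?thesis
    using assms by auto
qed

lemma powr_inverse_le_iff:
  fixes u x a :: real
  assumes "0 < u" "0 \<le> x" "0 < a"
  shows "u powr (1 / a) \<le> x \<longleftrightarrow> u \<le> x powr a"
proof -
  have "u powr (1 / a) \<le> x \<longleftrightarrow> (u powr (1 / a)) powr a \<le> x powr a"
    using assms by (metis linorder_not_less powr_ge_zero powr_less_mono2 powr_mono2 less_imp_le)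
  with assms show ?thesis
    by (simp add: powr_powr)
qed

lemma powr_inverse_less_iff:
  fixes u x a :: real
  assumes "0 < u" "0 \<le> x" "0 < a"
  shows "x < u powr (1 / a) \<longleftrightarrow> x powr a < u"
  using powr_inverse_le_iff[OF assms] by linarith

text \<open>Raising to a positive power maps Lebesgue null sets of \<open>(0, 1)\<close> to null sets, being
  differentiable there.\<close>

lemma measure_unif_vimage_powr_eq_0:
  fixes a b :: real
  assumes "0 < a" "0 < b" and [measurable]: "S \<in> sets borel"
    and null: "measure unif {v. v powr (1 / b) \<in> S} = 0"
  shows "measure unif {v. v powr (1 / a) \<in> S} = 0"
proof -
  define N where "N r = {0<..<1} \<inter> {v. v powr (1 / r) \<in> S}" for r :: real
  have [measurable]: "{v. v powr (1 / r) \<in> S} \<in> sets borel" for r :: real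
    by measurable
  have N_sets: "N r \<in> sets lborel" for r
    unfolding N_def by simp
  \<comment> \<open>\<open>measure\<close> also returns 0 on sets of infinite
    \<open>emeasure\<close>, so finiteness is what lets a zero \<open>measure\<close> mean a null
    set.\<close>
  have fin: "emeasure lborel (N r) < \<infinity>" for r
    by (rule order.strict_trans1[OF emeasure_mono[of _ "{0<..<1}"]]) (auto simp: N_def)
  have null_iff: "measure unif {v. v powr (1 / r) \<in> S} = 0 \<longleftrightarrow> negligible (N r)" for r
  proof -
    have "measure unif {v. v powr (1 / r) \<in> S} = measure lborel (N r)"
      unfolding N_def by (rule measure_unif) measurable
    also have "\<dots> = 0 \<longleftrightarrow> emeasure lborel (N r) = 0"
      using fin[of r] by (auto simp: measure_def enn2real_eq_0_iff)
    also have "\<dots> \<longleftrightarrow> negligible (N r)"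
      using N_sets[of r] by (auto simp: negligible_iff_null_sets null_sets_completion_iff null_sets_def)
    finally show ?thesis .
  qed
  \<comment> \<open>For positive v and w, \<open>v powr (1 / a) = w powr (1 / b)\<close> amounts to
    \<open>v = w powr (a / b)\<close>. Hence this map carries the given null set \<open>N b\<close>
    over all of \<open>N a\<close>.\<close>
  have "(\<lambda>w. w powr (a / b)) differentiable_on N b"
    unfolding differentiable_on_def
  proof
    fix w assume "w \<in> N b"
    then have "w > 0" by (simp add: N_def)
    then have "((\<lambda>w. w powr (a / b)) has_real_derivative (a / b) * w powr (a / b - 1)) (at w within N b)"
      by (intro has_real_derivative_powr DERIV_subset[OF has_real_derivative_powr]) auto
    then show "(\<lambda>w. w powr (a / b)) differentiable (at w within N b)"
      using has_field_derivative_imp_has_derivative differentiable_def by blast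
  qed
  moreover have "negligible (N b)"
    using null null_iff by blast
  ultimately have "negligible ((\<lambda>w. w powr (a / b)) ` N b)"
    by (intro negligible_differentiable_image_negligible) auto
  moreover have "N a \<subseteq> (\<lambda>w. w powr (a / b)) ` N b"
  proof
    fix v assume v: "v \<in> N a"
    have "v powr (b / a) < 1 powr (b / a)"
      using v assms by (intro powr_less_mono2) (auto simp: N_def)
    then have "v powr (b / a) \<in> N b" "v = (v powr (b / a)) powr (a / b)"
      using v assms by (auto simp: N_def powr_powr)
    then show "v \<in> (\<lambda>w. w powr (a / b)) ` N b" by blast
  qed
  ultimately show ?thesis
    using null_iff negligible_subset by blast
qed

section \<open>Events determined by past or present\<close>

text \<open>Preimages under a single map already form a sigma-algebra. An event of the present can
  thus be written as a condition \<open>X n \<omega> \<in> S\<close>.\<close>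

lemma sets_generated_algebra_singleton:
  "sets (generated_algebra M {n} X) = {X n -` B \<inter> space M | B. B \<in> sets borel}"
proof -
  have "sets (generated_algebra M {n} X) = sets (vimage_algebra (space M) (X n) borel)"
    unfolding generated_algebra_def sets_vimage_algebra by (subst sets_measure_of) auto
  then show ?thesis by (simp add: sets_vimage_algebra2)
qed

lemma measurable_generated_algebra:
  "k \<in> K \<Longrightarrow> X k \<in> borel_measurable (generated_algebra M K X)"
  unfolding generated_algebra_def
  by (rule measurableI) (auto simp: space_measure_of_conv intro!: in_measure_of)

lemma space_generated_algebra [simp]: "space (generated_algebra M K X) = space M"
  by (simp add: generated_algebra_def space_measure_of_conv)

section \<open>The driving sequence and its box probabilities\<close>

locale max_process = prob_space M for M :: "'a measure" +
  fixes I :: "int set" and U X :: "int \<Rightarrow> 'a \<Rightarrow> real" and \<alpha> \<beta> :: real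
  assumes \<alpha>_pos: "\<alpha> > 0" and \<beta>_pos: "\<beta> > 0"
    and indep_U: "indep_vars (\<lambda>_. borel) U (I \<union> (\<lambda>n. n - 1) ` I)"
    and distr_U: "\<And>n. n \<in> I \<union> (\<lambda>n. n - 1) ` I \<Longrightarrow> distr M borel (U n) = unif"
    and X_eq: "\<And>n \<omega>. n \<in> I \<Longrightarrow> \<omega> \<in> space M \<Longrightarrow>
           X n \<omega> = max (U n \<omega> powr (1 / \<alpha>)) (U (n - 1) \<omega> powr (1 / \<beta>))"
begin

text \<open>The indices of the driving variables: \<open>X n\<close> also reads
  \<open>U (n - 1)\<close>, so over \<open>{0..}\<close> they start at -1.\<close>

abbreviation T where "T \<equiv> I \<union> (\<lambda>n. n - 1) ` I"

lemma U_measurable: "n \<in> T \<Longrightarrow> U n \<in> borel_measurable M"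
  using indep_U unfolding indep_vars_def by blast

lemma X_measurable:
  assumes "n \<in> I"
  shows "X n \<in> borel_measurable M"
proof -
  have [measurable]: "U n \<in> borel_measurable M" "U (n - 1) \<in> borel_measurable M"
    using assms by (auto intro!: U_measurable)
  have "(\<lambda>\<omega>. max (U n \<omega> powr (1 / \<alpha>)) (U (n - 1) \<omega> powr (1 / \<beta>))) \<in> borel_measurable M"
    by measurable
  then show ?thesis
    using X_eq[OF assms] by (simp cong: measurable_cong)
qed

lemma real_process_X: "real_process M I X"
  unfolding real_process_def using X_measurable prob_space_axioms by blast

lemma prob_U:
  assumes "n \<in> T" "A \<in> sets borel"
  shows "prob (U n -` A \<inter> space M) = measure unif A"
  using measure_distr[OF U_measurable[OF assms(1)], of A] assms distr_U by simp

lemma AE_U: "n \<in> T \<Longrightarrow> AE \<omega> in M. 0 < U n \<omega> \<and> U n \<omega> < 1"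
proof -
  assume n: "n \<in> T"
  have "AE x in unif. x \<in> {0<..<1}"
    by (rule AE_uniform_measureI) auto
  then have "AE x in distr M borel (U n). x \<in> {0<..<1}"
    unfolding distr_U[OF n] .
  then show ?thesis
    using U_measurable[OF n] by (subst (asm) AE_distr_iff) auto
qed

lemma prob_rectangle:
  assumes "J \<subseteq> T" "finite J" "J \<noteq> {}" "\<And>j. j \<in> J \<Longrightarrow> A j \<in> sets borel"
  shows "prob {\<omega> \<in> space M. \<forall>j\<in>J. U j \<omega> \<in> A j} = (\<Prod>j\<in>J. measure unif (A j))"
proof -
  have "{\<omega> \<in> space M. \<forall>j\<in>J. U j \<omega> \<in> A j} = (\<Inter>j\<in>J. U j -` A j \<inter> space M)"
    using assms by auto
  also have "prob \<dots> = (\<Prod>j\<in>J. prob (U j -` A j \<inter> space M))"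
    by (rule indep_varsD[OF indep_U assms(3,2,1,4)])
  also have "\<dots> = (\<Prod>j\<in>J. measure unif (A j))"
  proof (rule prod.cong)
    fix j assume "j \<in> J"
    then show "prob (U j -` A j \<inter> space M) = measure unif (A j)"
      by (intro prob_U[OF subsetD[OF assms(1)] assms(4)])
  qed simp
  finally show ?thesis .
qed

lemma prob_rectangle2:
  assumes "i \<in> T" "j \<in> T" "i \<noteq> j" "A \<in> sets borel" "B \<in> sets borel"
  shows "prob {\<omega> \<in> space M. U i \<omega> \<in> A \<and> U j \<omega> \<in> B} = measure unif A * measure unif B"
  using prob_rectangle[of "{i, j}" "(\<lambda>_. B)(i := A)"] assms by auto

lemma prob_rectangle3:
  assumes "i \<in> T" "j \<in> T" "k \<in> T" "i \<noteq> j" "i \<noteq> k" "j \<noteq> k"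
    and "A \<in> sets borel" "B \<in> sets borel" "C \<in> sets borel"
  shows "prob {\<omega> \<in> space M. U i \<omega> \<in> A \<and> U j \<omega> \<in> B \<and> U k \<omega> \<in> C} =
    measure unif A * measure unif B * measure unif C"
  using prob_rectangle[of "{i, j, k}" "(\<lambda>_. C)(i := A, j := B)"] assms
  by (auto simp: mult.assoc fun_upd_def)

section \<open>One- and two-dimensional distribution functions\<close>

text \<open>A maximum is at most x iff both terms are, and each root can be inverted for a positive
  base. Since \<open>U n\<close> and \<open>U (n - 1)\<close> are positive only almost surely, so is
  the equivalence.\<close>

lemma AE_X_le_iff:
  assumes "n \<in> I" "0 \<le> x"
  shows "AE \<omega> in M. X n \<omega> \<le> x \<longleftrightarrow> U n \<omega> \<le> x powr \<alpha> \<and> U (n - 1) \<omega> \<le> x powr \<beta>"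
proof -
  have "n \<in> T" "n - 1 \<in> T" using assms by auto
  from AE_U[OF this(1)] AE_U[OF this(2)] AE_space show ?thesis
    by eventually_elim (use assms \<alpha>_pos \<beta>_pos in \<open>simp add: X_eq powr_inverse_le_iff\<close>)
qed

lemma prob_X_le:
  assumes "n \<in> I" "0 \<le> x" "x \<le> 1"
  shows "prob {\<omega> \<in> space M. X n \<omega> \<le> x} = x powr (\<alpha> + \<beta>)"
proof -
  have T: "n \<in> T" "n - 1 \<in> T" using assms by auto
  note [measurable] = X_measurable[OF assms(1)] U_measurable[OF T(1)] U_measurable[OF T(2)]
  have "prob {\<omega> \<in> space M. X n \<omega> \<le> x} =
    prob {\<omega> \<in> space M. U n \<omega> \<in> {..x powr \<alpha>} \<and> U (n - 1) \<omega> \<in> {..x powr \<beta>}}"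
    using AE_X_le_iff[OF assms(1,2)] by (intro finite_measure_eq_AE) (auto elim!: eventually_mono)
  also have "\<dots> = x powr \<alpha> * x powr \<beta>"
    using T assms \<alpha>_pos \<beta>_pos
    by (subst prob_rectangle2) (auto simp: measure_unif_atMost powr_le1)
  finally show ?thesis by (simp add: powr_add)
qed

lemma distr_X:
  assumes "n \<in> I"
  shows "distr M borel (X n) = PFD (\<alpha> + \<beta>)"
proof (rule cdf_unique)
  have pos: "\<alpha> + \<beta> > 0" using \<alpha>_pos \<beta>_pos by simp
  note [measurable] = X_measurable[OF assms]
  show "real_distribution (distr M borel (X n))"
    by simp
  show "real_distribution (PFD (\<alpha> + \<beta>))"
    by (rule real_distribution_PFD[OF pos])
  have "cdf (distr M borel (X n)) x = PFD_cdf (\<alpha> + \<beta>) x" for x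
  proof -
    have cdf: "cdf (distr M borel (X n)) x = prob {\<omega> \<in> space M. X n \<omega> \<le> x}"
      by (auto simp: cdf_def measure_distr vimage_def Int_def conj_commute intro!: arg_cong[where f = prob])
    consider "x < 0" | "0 \<le> x" "x \<le> 1" | "1 < x" by linarith
    then show ?thesis
    proof cases
      case 1
      have "0 \<le> X n \<omega>" if "\<omega> \<in> space M" for \<omega>
        using X_eq[OF assms that] by (simp add: le_max_iff_disj)
      then have "{\<omega> \<in> space M. X n \<omega> \<le> x} = {}"
        using 1 by force
      then show ?thesis using 1 by (simp only: cdf PFD_cdf_def) simp
    next
      case 2
      then show ?thesis by (simp add: cdf prob_X_le[OF assms] PFD_cdf_def)
    next
      case 3
      \<comment> \<open>The formula already gives probability 1 at the argument 1, so monotonicity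
        settles the rest.\<close>
      have "prob {\<omega> \<in> space M. X n \<omega> \<le> 1} \<le> prob {\<omega> \<in> space M. X n \<omega> \<le> x}"
        using 3 by (intro finite_measure_mono) auto
      with prob_X_le[OF assms, of 1] have "prob {\<omega> \<in> space M. X n \<omega> \<le> x} = 1"
        using prob_le_1[of "{\<omega> \<in> space M. X n \<omega> \<le> x}"] by simp
      then show ?thesis using 3 by (simp add: cdf PFD_cdf_def)
    qed
  qed
  then show "cdf (distr M borel (X n)) = cdf (PFD (\<alpha> + \<beta>))"
    by (auto simp: cdf_PFD[OF pos])
qed

text \<open>The two events share only \<open>U (n - 1)\<close>, which gets the bound
  \<open>x powr \<alpha>\<close> from \<open>X (n - 1)\<close> and \<open>y powr \<beta>\<close>
  from \<open>X n\<close>; this is the source of the minimum. The other two factors come from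
  \<open>U n\<close> and \<open>U (n - 2)\<close>.\<close>

lemma prob_X_le_X_le:
  assumes "n - 1 \<in> I" "n \<in> I" "0 \<le> x" "x \<le> 1" "0 \<le> y" "y \<le> 1"
  shows "prob {\<omega> \<in> space M. X (n - 1) \<omega> \<le> x \<and> X n \<omega> \<le> y} =
    y powr \<alpha> * x powr \<beta> * min (y powr \<beta>) (x powr \<alpha>)"
proof -
  have T: "n \<in> T" "n - 1 \<in> T" "n - 2 \<in> T"
    using assms by (auto simp: image_iff intro: bexI[of _ "n - 1"])
  note [measurable] = X_measurable[OF assms(1)] X_measurable[OF assms(2)]
    U_measurable[OF T(1)] U_measurable[OF T(2)] U_measurable[OF T(3)]
  have "prob {\<omega> \<in> space M. X (n - 1) \<omega> \<le> x \<and> X n \<omega> \<le> y} =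
    prob {\<omega> \<in> space M. U n \<omega> \<in> {..y powr \<alpha>} \<and> U (n - 2) \<omega> \<in> {..x powr \<beta>} \<and>
      U (n - 1) \<omega> \<in> {..min (y powr \<beta>) (x powr \<alpha>)}}"
  proof (rule finite_measure_eq_AE)
    from AE_X_le_iff[OF assms(1,3)] AE_X_le_iff[OF assms(2,5)]
    show "AE \<omega> in M. \<omega> \<in> {\<omega> \<in> space M. X (n - 1) \<omega> \<le> x \<and> X n \<omega> \<le> y} \<longleftrightarrow>
      \<omega> \<in> {\<omega> \<in> space M. U n \<omega> \<in> {..y powr \<alpha>} \<and> U (n - 2) \<omega> \<in> {..x powr \<beta>} \<and>
        U (n - 1) \<omega> \<in> {..min (y powr \<beta>) (x powr \<alpha>)}}"
      by eventually_elim auto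
  qed measurable
  also have "\<dots> = y powr \<alpha> * x powr \<beta> * min (y powr \<beta>) (x powr \<alpha>)"
    using T assms \<alpha>_pos \<beta>_pos
    by (subst prob_rectangle3) (auto simp: measure_unif_atMost powr_le1 min_le_iff_disj)
  finally show ?thesis .
qed

section \<open>Stationarity\<close>

text \<open>Translation is injective, so the product formula for a finite \<open>K\<close> is the
  one for its translate, reindexed.\<close>

lemma indep_sets_shift:
  fixes F :: "int \<Rightarrow> 'a set set"
  assumes "indep_sets F L" "(\<lambda>j. j + h) ` J \<subseteq> L"
  shows "indep_sets (\<lambda>j. F (j + h)) J"
proof (rule indep_setsI)
  fix j assume "j \<in> J"
  then show "F (j + h) \<subseteq> events"
    using assms unfolding indep_sets_def by blast
next
  fix A K assume K: "K \<noteq> {}" "K \<subseteq> J" "finite K" "\<forall>j\<in>K. A j \<in> F (j + h)"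
  have "prob (\<Inter>k\<in>(\<lambda>j. j + h) ` K. A (k - h)) = (\<Prod>k\<in>(\<lambda>j. j + h) ` K. prob (A (k - h)))"
    using K assms by (intro indep_setsD[OF assms(1)]) auto
  then show "prob (\<Inter>j\<in>K. A j) = (\<Prod>j\<in>K. prob (A j))"
    by (simp add: prod.reindex inj_on_def)
qed

lemma distr_U_shift:
  assumes "J \<noteq> {}" "J \<subseteq> T" "(\<lambda>j. j + h) ` J \<subseteq> T"
  shows "distr M (\<Pi>\<^sub>M j\<in>J. borel) (\<lambda>\<omega>. \<lambda>j\<in>J. U (j + h) \<omega>) = (\<Pi>\<^sub>M j\<in>J. unif)"
proof -
  have m: "U (j + h) \<in> borel_measurable M" if "j \<in> J" for j
    using that assms by (intro U_measurable) auto
  have "indep_vars (\<lambda>_. borel) (\<lambda>j. U (j + h)) J"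
  proof -
    have "indep_sets (\<lambda>j. {U j -` A \<inter> space M | A. A \<in> sets borel}) T"
      using indep_U unfolding indep_vars_def2 by blast
    then have "indep_sets (\<lambda>j. {U (j + h) -` A \<inter> space M | A. A \<in> sets borel}) J"
      by (rule indep_sets_shift) fact
    then show ?thesis using m unfolding indep_vars_def2 by blast
  qed
  then have "distr M (\<Pi>\<^sub>M j\<in>J. borel) (\<lambda>\<omega>. \<lambda>j\<in>J. U (j + h) \<omega>) =
    (\<Pi>\<^sub>M j\<in>J. distr M borel (U (j + h)))"
    using m assms(1) by (subst (asm) indep_vars_iff_distr_eq_PiM') auto
  also have "\<dots> = (\<Pi>\<^sub>M j\<in>J. unif)"
    using assms by (intro PiM_cong distr_U) auto
  finally show ?thesis .
qed

text \<open>For every h the shifted \<open>X\<close> is the same measurable function of the shifted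
  \<open>U\<close>, whose law is a product of copies of \<open>unif\<close>. As h is absent from the
  right-hand side, stationarity follows by comparing h with 0.\<close>

lemma distr_X_shift:
  assumes "J \<noteq> {}" "J \<subseteq> I" "(\<lambda>j. j + h) ` J \<subseteq> I"
  defines "K \<equiv> J \<union> (\<lambda>j. j - 1) ` J"
  shows "distr M (\<Pi>\<^sub>M j\<in>J. borel) (\<lambda>\<omega>. \<lambda>j\<in>J. X (j + h) \<omega>) =
    distr (\<Pi>\<^sub>M k\<in>K. unif) (\<Pi>\<^sub>M j\<in>J. borel)
      (\<lambda>u. \<lambda>j\<in>J. max (u j powr (1 / \<alpha>)) (u (j - 1) powr (1 / \<beta>)))"
    (is "_ = distr _ _ ?f")
proof -
  have f: "?f \<in> measurable (\<Pi>\<^sub>M k\<in>K. borel) (\<Pi>\<^sub>M j\<in>J. borel)"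
  proof (rule measurable_restrict)
    fix j assume "j \<in> J"
    then have [measurable]: "(\<lambda>u. u j) \<in> borel_measurable (\<Pi>\<^sub>M k\<in>K. borel :: real measure)"
      "(\<lambda>u. u (j - 1)) \<in> borel_measurable (\<Pi>\<^sub>M k\<in>K. borel :: real measure)"
      by (auto simp: K_def intro!: measurable_component_singleton)
    show "(\<lambda>u. max (u j powr (1 / \<alpha>)) (u (j - 1) powr (1 / \<beta>))) \<in> borel_measurable (\<Pi>\<^sub>M k\<in>K. borel)"
      by measurable
  qed
  have KT: "K \<noteq> {}" "K \<subseteq> T" "(\<lambda>j. j + h) ` K \<subseteq> T"
  proof -
    have "j - 1 + h \<in> T" if "j \<in> J" for j
      using assms(3) that by (auto simp: image_iff intro!: disjI2 bexI[of _ "j + h"])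
    then show "K \<noteq> {}" "K \<subseteq> T" "(\<lambda>j. j + h) ` K \<subseteq> T"
      using assms by auto
  qed
  have U: "(\<lambda>\<omega>. \<lambda>k\<in>K. U (k + h) \<omega>) \<in> measurable M (\<Pi>\<^sub>M k\<in>K. borel)"
    using KT by (intro measurable_restrict U_measurable) auto
  have "distr M (\<Pi>\<^sub>M j\<in>J. borel) (\<lambda>\<omega>. \<lambda>j\<in>J. X (j + h) \<omega>) =
    distr M (\<Pi>\<^sub>M j\<in>J. borel) (?f \<circ> (\<lambda>\<omega>. \<lambda>k\<in>K. U (k + h) \<omega>))"
  proof (rule distr_cong)
    fix \<omega> assume "\<omega> \<in> space M"
    then show "(\<lambda>j\<in>J. X (j + h) \<omega>) = (?f \<circ> (\<lambda>\<omega>. \<lambda>k\<in>K. U (k + h) \<omega>)) \<omega>"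
      using assms(3) by (auto simp: K_def X_eq image_subset_iff fun_eq_iff algebra_simps)
  qed auto
  also have "\<dots> = distr (distr M (\<Pi>\<^sub>M k\<in>K. borel) (\<lambda>\<omega>. \<lambda>k\<in>K. U (k + h) \<omega>)) (\<Pi>\<^sub>M j\<in>J. borel) ?f"
    by (rule distr_distr[OF f U, symmetric])
  also have "\<dots> = distr (\<Pi>\<^sub>M k\<in>K. unif) (\<Pi>\<^sub>M j\<in>J. borel) ?f"
    using KT by (subst distr_U_shift) auto
  finally show ?thesis .
qed

lemma stationary_X: "stationary_process M I X"
  unfolding stationary_process_def
proof (intro conjI allI impI)
  show "real_process M I X" by (rule real_process_X)
  fix J h assume J: "finite J" "J \<subseteq> I" "(\<lambda>j. j + h) ` J \<subseteq> I"
  show "distr M (\<Pi>\<^sub>M j\<in>J. borel) (\<lambda>\<omega>. \<lambda>j\<in>J. X (j + h) \<omega>) =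
    distr M (\<Pi>\<^sub>M j\<in>J. borel) (\<lambda>\<omega>. \<lambda>j\<in>J. X j \<omega>)"
  proof (cases "J = {}")
    \<comment> \<open>Over the empty index set both maps are the same constant.\<close>
    case True
    then show ?thesis by (simp add: restrict_def)
  next
    case False
    with J distr_X_shift[of J h] distr_X_shift[of J 0] show ?thesis by simp
  qed
qed

section \<open>Failure of the Markov property\<close>

lemma not_markov_X:
  assumes n: "n - 1 \<in> I" "n \<in> I" "n + 1 \<in> I"
  shows "\<not> markov_process M I X"
proof
  assume markov: "markov_process M I X"
  define c where "c = (1 / 2 :: real)"
  have c: "0 < c" "c < 1" by (auto simp: c_def)
  \<comment> \<open>With this y, a positive \<open>U n\<close> pushes \<open>X n\<close> above c and
    \<open>X (n + 1)\<close> above y at one and the same threshold,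
    \<open>U n > c powr \<alpha>\<close>.\<close>
  define y where "y = c powr (\<alpha> / \<beta>)"
  have y: "0 < y" "y < 1" "y powr \<beta> = c powr \<alpha>"
    using c \<alpha>_pos \<beta>_pos powr_less_mono2[of "\<alpha> / \<beta>" c 1] by (auto simp: y_def powr_powr)
  have T: "n + 1 \<in> T" "n \<in> T" "n - 1 \<in> T" "n - 2 \<in> T"
    using n by (auto simp: image_iff intro!: disjI2 bexI[of _ "n - 1"])
  note [measurable] = X_measurable[OF n(1)] X_measurable[OF n(2)] X_measurable[OF n(3)]
    U_measurable[OF T(1)] U_measurable[OF T(2)] U_measurable[OF T(3)] U_measurable[OF T(4)]
  define P where "P = {k \<in> I. k \<le> n}"
  define A where "A = {\<omega> \<in> space M. X (n + 1) \<omega> \<in> {..y}}"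
  define f where "f = real_cond_exp M (generated_algebra M P X) (indicator A)"
  define g where "g = real_cond_exp M (generated_algebra M {n} X) (indicator A)"
  have fg: "AE \<omega> in M. f \<omega> = g \<omega>"
    using markov[unfolded markov_process_def, THEN conjunct2, rule_format, OF n(2,3), of "{..y}"]
    by (simp add: f_def g_def P_def A_def)
  have [measurable]: "A \<in> events" unfolding A_def by measurable
  have int_A: "integrable M (indicator A :: 'a \<Rightarrow> real)"
    by (simp add: less_top[symmetric])
  interpret past: finite_measure_subalgebra M "generated_algebra M P X"
    by unfold_locales (rule subalgebra_generated_algebra[OF real_process_X], simp add: P_def)
  interpret present: finite_measure_subalgebra M "generated_algebra M {n} X"
    by unfold_locales (rule subalgebra_generated_algebra[OF real_process_X], simp add: n)
  have g_meas [measurable]: "g \<in> borel_measurable M"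
    unfolding g_def by simp
  have g_nonneg: "AE \<omega> in M. g \<omega> \<ge> 0"
    unfolding g_def by (rule present.real_cond_exp_pos) auto
  define H where "H = {\<omega> \<in> space M. X (n - 1) \<omega> powr \<alpha> < X n \<omega> powr \<beta> \<and> c < X n \<omega>}"
  have [measurable]: "H \<in> events" unfolding H_def by measurable
  have "H \<in> sets (generated_algebra M P X)"
  proof -
    have [measurable]: "X (n - 1) \<in> borel_measurable (generated_algebra M P X)"
      "X n \<in> borel_measurable (generated_algebra M P X)"
      using n by (auto intro!: measurable_generated_algebra simp: P_def)
    have "{\<omega> \<in> space (generated_algebra M P X). X (n - 1) \<omega> powr \<alpha> < X n \<omega> powr \<beta> \<and> c < X n \<omega>}
      \<in> sets (generated_algebra M P X)"
      by measurable
    then show ?thesis by (simp add: H_def)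
  qed
  have H_A: "AE \<omega> in M. \<not> (\<omega> \<in> H \<and> \<omega> \<in> A)"
    using AE_U[OF T(1)] AE_U[OF T(2)] AE_U[OF T(3)] AE_U[OF T(4)] AE_space
  proof eventually_elim
    case (elim \<omega>)
    show ?case
    proof
      assume H: "\<omega> \<in> H \<and> \<omega> \<in> A"
      \<comment> \<open>\<open>X (n - 1)\<close> bounds \<open>U (n - 1)\<close> from above, so on
        \<open>H\<close> the term of \<open>U (n - 1)\<close> in the maximum \<open>X n\<close>
        falls short of it.\<close>
      have "(U (n - 1) \<omega> powr (1 / \<alpha>)) powr \<alpha> \<le> X (n - 1) \<omega> powr \<alpha>"
        using elim n \<alpha>_pos by (intro powr_mono2) (auto simp: X_eq)
      then have "U (n - 1) \<omega> < X n \<omega> powr \<beta>"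
        using H elim \<alpha>_pos by (auto simp: H_def powr_powr)
      then have "U (n - 1) \<omega> powr (1 / \<beta>) < (X n \<omega> powr \<beta>) powr (1 / \<beta>)"
        using elim \<beta>_pos by (intro powr_less_mono2) auto
      also have "\<dots> = X n \<omega>"
        using H c \<beta>_pos by (simp add: H_def powr_powr)
      finally have "c < U n \<omega> powr (1 / \<alpha>)"
        using H elim n by (auto simp: H_def X_eq max_def split: if_splits)
      then have "y powr \<beta> < U n \<omega>"
        using powr_inverse_less_iff[of "U n \<omega>" c \<alpha>] elim c \<alpha>_pos y by simp
      then have "y < U n \<omega> powr (1 / \<beta>)"
        using powr_inverse_less_iff[of "U n \<omega>" y \<beta>] elim y \<beta>_pos by simp
      then show False
        using H elim n by (simp add: A_def X_eq)
    qed
  qed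
  have g_H: "AE \<omega> in M. \<omega> \<in> H \<longrightarrow> g \<omega> = 0"
  proof -
    \<comment> \<open>\<open>H\<close> involves \<open>X (n - 1)\<close>, so averaging over it is
      legitimate for \<open>f\<close>, the conditional probability given the past. The Markov
      property transfers the zero integral to \<open>g\<close>, which is nonnegative.\<close>
    have "(LINT \<omega>:H|M. g \<omega>) = (LINT \<omega>:H|M. f \<omega>)"
    proof (rule set_lebesgue_integral_cong_AE)
      show "AE \<omega> \<in> H in M. g \<omega> = f \<omega>"
        using fg by eventually_elim simp
    qed (auto simp: f_def)
    also have "\<dots> = (LINT \<omega>:H|M. indicator A \<omega>)"
      unfolding f_def by (rule past.real_cond_exp_intA[symmetric]) fact+
    also have "\<dots> = 0"
      unfolding set_lebesgue_integral_def using H_A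
      by (intro integral_eq_zero_AE) (auto elim!: eventually_mono simp: indicator_def)
    finally have "(LINT \<omega>|M. indicator H \<omega> * g \<omega>) = 0"
      by (simp add: set_lebesgue_integral_def)
    moreover have "integrable M (\<lambda>\<omega>. indicator H \<omega> * g \<omega>)"
      using integrable_real_mult_indicator[OF \<open>H \<in> events\<close> present.real_cond_exp_int(1)[OF int_A]]
      by (simp add: g_def mult.commute)
    moreover have "AE \<omega> in M. 0 \<le> indicator H \<omega> * g \<omega>"
      using g_nonneg by eventually_elim simp
    ultimately have "AE \<omega> in M. indicator H \<omega> * g \<omega> = 0"
      by (simp add: integral_nonneg_eq_0_iff_AE)
    then show ?thesis by eventually_elim (auto simp: indicator_def)
  qed
  \<comment> \<open>An event of the present that contains \<open>H\<close> up to a null set.\<close>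
  define D where "D = {\<omega> \<in> space M. g \<omega> = 0 \<and> c < X n \<omega>}"
  have D_sets: "D \<in> sets (generated_algebra M {n} X)"
  proof -
    have [measurable]: "X n \<in> borel_measurable (generated_algebra M {n} X)"
      "g \<in> borel_measurable (generated_algebra M {n} X)"
      by (auto intro!: measurable_generated_algebra simp: g_def)
    have "{\<omega> \<in> space (generated_algebra M {n} X). g \<omega> = 0 \<and> c < X n \<omega>}
      \<in> sets (generated_algebra M {n} X)"
      by measurable
    then show ?thesis by (simp add: D_def)
  qed
  then obtain S where S [measurable]: "S \<in> sets borel" and D_eq: "D = X n -` S \<inter> space M"
    by (auto simp: sets_generated_algebra_singleton)
  have [measurable]: "D \<in> events" unfolding D_def by measurable
  \<comment> \<open>\<open>S\<close> is arbitrary outside the range of \<open>X n\<close>; after the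
    cut, membership itself forces values above c.\<close>
  define S' where "S' = S \<inter> {c<..}"
  have [measurable]: "S' \<in> sets borel" unfolding S'_def by simp
  have D_iff: "\<omega> \<in> D \<longleftrightarrow> \<omega> \<in> space M \<and> X n \<omega> \<in> S'" for \<omega>
    using D_eq by (auto simp: S'_def D_def)
  \<comment> \<open>\<open>N \<alpha>\<close> serves when \<open>U n\<close> attains the maximum
    \<open>X n\<close>, and \<open>N \<beta>\<close> when \<open>U (n - 1)\<close> does.\<close>
  define N where "N r = {v. v powr (1 / r) \<in> S'}" for r :: real
  have N_sets [measurable]: "N r \<in> sets borel" for r
    unfolding N_def by measurable
  have "measure M (D \<inter> A) = 0"
  proof -
    have "measure M (D \<inter> A) = (LINT \<omega>:D|M. indicator A \<omega>)"
      by (simp add: set_lebesgue_integral_def indicator_inter_arith[symmetric])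
    also have "\<dots> = (LINT \<omega>:D|M. g \<omega>)"
      unfolding g_def by (rule present.real_cond_exp_intA) fact+
    also have "\<dots> = 0"
      unfolding set_lebesgue_integral_def
      by (intro integral_eq_zero_AE) (auto simp: indicator_def D_def)
    finally show ?thesis .
  qed
  \<comment> \<open>On this box \<open>U (n - 1)\<close> attains the maximum and puts
    \<open>X n\<close> into \<open>S'\<close>. Since
    \<open>c powr \<alpha> = y powr \<beta>\<close>, the bounds on \<open>U n\<close> and
    \<open>U (n + 1)\<close> also give \<open>X (n + 1) \<le> y\<close>. The box thus lies in a null
    event, and independence leaves \<open>N \<beta>\<close> as the null factor.\<close>
  moreover have "prob {\<omega> \<in> space M. U (n - 1) \<omega> \<in> N \<beta> \<and> U n \<omega> \<in> {..c powr \<alpha>} \<and> U (n + 1) \<omega> \<in> {..y powr \<alpha>}}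
      \<le> measure M (D \<inter> A)"
  proof (rule finite_measure_mono_AE)
    show "AE \<omega> in M. \<omega> \<in> {\<omega> \<in> space M. U (n - 1) \<omega> \<in> N \<beta> \<and> U n \<omega> \<in> {..c powr \<alpha>} \<and> U (n + 1) \<omega> \<in> {..y powr \<alpha>}}
      \<longrightarrow> \<omega> \<in> D \<inter> A"
      using AE_U[OF T(2)] AE_X_le_iff[OF n(3), of y, OF less_imp_le[OF y(1)]]
    proof eventually_elim
      case (elim \<omega>)
      show ?case
      proof
        assume *: "\<omega> \<in> {\<omega> \<in> space M. U (n - 1) \<omega> \<in> N \<beta> \<and> U n \<omega> \<in> {..c powr \<alpha>} \<and> U (n + 1) \<omega> \<in> {..y powr \<alpha>}}"
        have "U n \<omega> powr (1 / \<alpha>) \<le> c"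
          using * elim c \<alpha>_pos by (simp add: powr_inverse_le_iff)
        moreover have "c < U (n - 1) \<omega> powr (1 / \<beta>)"
          using * by (simp add: N_def S'_def)
        ultimately have "X n \<omega> = U (n - 1) \<omega> powr (1 / \<beta>)"
          using * n by (simp add: X_eq)
        then show "\<omega> \<in> D \<inter> A"
          using * elim y by (auto simp: D_iff N_def A_def)
      qed
    qed
  qed measurable
  moreover have "prob {\<omega> \<in> space M. U (n - 1) \<omega> \<in> N \<beta> \<and> U n \<omega> \<in> {..c powr \<alpha>} \<and> U (n + 1) \<omega> \<in> {..y powr \<alpha>}} =
    measure unif (N \<beta>) * c powr \<alpha> * y powr \<alpha>"
    using T c y \<alpha>_pos by (subst prob_rectangle3) (auto simp: measure_unif_atMost powr_le1)
  ultimately have "measure unif (N \<beta>) * (c powr \<alpha> * y powr \<alpha>) \<le> 0"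
    by (simp add: mult.assoc)
  moreover have "0 < c powr \<alpha> * y powr \<alpha>" using c y by simp
  ultimately have N_\<beta>: "measure unif (N \<beta>) = 0"
    using measure_nonneg[of unif "N \<beta>"] c y by (simp add: mult_le_0_iff)
  then have N_\<alpha>: "measure unif (N \<alpha>) = 0"
    unfolding N_def by (rule measure_unif_vimage_powr_eq_0[OF \<alpha>_pos \<beta>_pos \<open>S' \<in> sets borel\<close>])
  have "prob H \<le> prob ((U n -` N \<alpha> \<inter> space M) \<union> (U (n - 1) -` N \<beta> \<inter> space M))"
  proof (rule finite_measure_mono_AE)
    show "AE \<omega> in M. \<omega> \<in> H \<longrightarrow> \<omega> \<in> (U n -` N \<alpha> \<inter> space M) \<union> (U (n - 1) -` N \<beta> \<inter> space M)"
      using g_H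
    proof eventually_elim
      case (elim \<omega>)
      show ?case
      proof
        assume "\<omega> \<in> H"
        then have "\<omega> \<in> D" using elim by (auto simp: D_def H_def)
        then show "\<omega> \<in> (U n -` N \<alpha> \<inter> space M) \<union> (U (n - 1) -` N \<beta> \<inter> space M)"
          using n by (auto simp: D_iff X_eq N_def max_def split: if_splits)
      qed
    qed
  qed measurable
  also have "\<dots> \<le> prob (U n -` N \<alpha> \<inter> space M) + prob (U (n - 1) -` N \<beta> \<inter> space M)"
    by (rule measure_Un_le) measurable
  also have "\<dots> = 0"
    using N_\<alpha> N_\<beta> T by (simp add: prob_U)
  finally have "prob H \<le> 0" .
  \<comment> \<open>It remains to bound \<open>prob H\<close> below. The level d separates the two
    sides in \<open>H\<close>: \<open>X n > c\<close> gives \<open>X n powr \<beta> > d\<close>,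
    while \<open>X (n - 1) \<le> d powr (1 / \<alpha>)\<close> gives
    \<open>X (n - 1) powr \<alpha> \<le> d\<close>. Both hold almost surely on a box in three
    independent variables.\<close>
  moreover define d where "d = c powr \<beta>"
  have d: "0 < d" "d < 1"
    using c \<beta>_pos powr_less_mono2[of \<beta> c 1] by (auto simp: d_def)
  have X_le: "AE \<omega> in M. X (n - 1) \<omega> \<le> d powr (1 / \<alpha>) \<longleftrightarrow>
    U (n - 1) \<omega> \<le> d \<and> U (n - 2) \<omega> \<le> d powr (\<beta> / \<alpha>)"
    using AE_X_le_iff[OF n(1), of "d powr (1 / \<alpha>)"] d \<alpha>_pos by (simp add: powr_powr)
  have "prob {\<omega> \<in> space M. U n \<omega> \<in> {c powr \<alpha><..} \<and> U (n - 1) \<omega> \<in> {..d} \<and> U (n - 2) \<omega> \<in> {..d powr (\<beta> / \<alpha>)}}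
    \<le> prob H"
  proof (rule finite_measure_mono_AE)
    show "AE \<omega> in M. \<omega> \<in> {\<omega> \<in> space M. U n \<omega> \<in> {c powr \<alpha><..} \<and> U (n - 1) \<omega> \<in> {..d} \<and> U (n - 2) \<omega> \<in> {..d powr (\<beta> / \<alpha>)}}
      \<longrightarrow> \<omega> \<in> H"
      using AE_U[OF T(2)] X_le
    proof eventually_elim
      case (elim \<omega>)
      show ?case
      proof
        assume *: "\<omega> \<in> {\<omega> \<in> space M. U n \<omega> \<in> {c powr \<alpha><..} \<and> U (n - 1) \<omega> \<in> {..d} \<and> U (n - 2) \<omega> \<in> {..d powr (\<beta> / \<alpha>)}}"
        have "c < U n \<omega> powr (1 / \<alpha>)"
          using * elim c \<alpha>_pos by (simp add: powr_inverse_less_iff)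
        then have cX: "c < X n \<omega>"
          using * n by (simp add: X_eq less_max_iff_disj)
        have "X (n - 1) \<omega> \<le> d powr (1 / \<alpha>)"
          using * elim by simp
        then have "X (n - 1) \<omega> powr \<alpha> \<le> (d powr (1 / \<alpha>)) powr \<alpha>"
          using * n \<alpha>_pos by (intro powr_mono2) (auto simp: X_eq le_max_iff_disj)
        also have "\<dots> = d" using \<alpha>_pos d by (simp add: powr_powr)
        also have "\<dots> < X n \<omega> powr \<beta>"
          unfolding d_def using cX c \<beta>_pos by (intro powr_less_mono2) auto
        finally show "\<omega> \<in> H" using * cX by (simp add: H_def)
      qed
    qed
  qed measurable
  moreover have "prob {\<omega> \<in> space M. U n \<omega> \<in> {c powr \<alpha><..} \<and> U (n - 1) \<omega> \<in> {..d} \<and> U (n - 2) \<omega> \<in> {..d powr (\<beta> / \<alpha>)}} =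
    (1 - c powr \<alpha>) * d * d powr (\<beta> / \<alpha>)"
    using T c d \<alpha>_pos \<beta>_pos
    by (subst prob_rectangle3) (auto simp: measure_unif_atMost measure_unif_greaterThan powr_le1)
  moreover have "0 < (1 - c powr \<alpha>) * d * d powr (\<beta> / \<alpha>)"
    using c d \<alpha>_pos powr_less_mono2[of \<alpha> c 1] by simp
  ultimately show False by linarith
qed

end

theorem theorem1:
  fixes M :: "'a measure"
    and I :: "int set"
    and U X :: "int \<Rightarrow> 'a \<Rightarrow> real"
    and \<alpha> \<beta> :: real
  assumes "prob_space M"
    and "\<alpha> > 0" and "\<beta> > 0"
    and "I = UNIV \<or> I = {0..}"
    and "prob_space.indep_vars M (\<lambda>_. borel) U (I \<union> (\<lambda>n. n - 1) ` I)"
    and "\<And>n. n \<in> I \<union> (\<lambda>n. n - 1) ` I \<Longrightarrow>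
           distr M borel (U n) = uniform_measure lborel {0<..<1}"
    and "\<And>n \<omega>. n \<in> I \<Longrightarrow> \<omega> \<in> space M \<Longrightarrow>
           X n \<omega> = max (U n \<omega> powr (1 / \<alpha>)) (U (n - 1) \<omega> powr (1 / \<beta>))"
  shows "(\<forall>n\<in>I. distr M borel (X n) = PFD (\<alpha> + \<beta>)) \<and>
    (\<forall>n x y. n - 1 \<in> I \<longrightarrow> n \<in> I \<longrightarrow> 0 \<le> x \<longrightarrow> x \<le> 1 \<longrightarrow> 0 \<le> y \<longrightarrow> y \<le> 1 \<longrightarrow>
       measure M {\<omega> \<in> space M. X (n - 1) \<omega> \<le> x \<and> X n \<omega> \<le> y} =
         y powr \<alpha> * x powr \<beta> * min (y powr \<beta>) (x powr \<alpha>)) \<and>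
    stationary_process M I X \<and>
    \<not> markov_process M I X"
proof -
  interpret max_process M I U X \<alpha> \<beta>
    using assms by (intro max_process.intro max_process_axioms.intro)
  \<comment> \<open>Three consecutive indices, 0, 1 and 2, common to both admissible index
    sets.\<close>
  have "1 - 1 \<in> I" "1 \<in> I" "1 + 1 \<in> I" using assms(4) by auto
  from distr_X prob_X_le_X_le stationary_X not_markov_X[OF this] show ?thesis by blast
qed

end
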